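(* For every $p\geq 2$, the integrand $B_p^+\colon\mathbb{R}^{2\times 2}\to[0,+\infty)$ is polyconvex.
   Context: $|A|=\max_{|\xi|=1}|A\xi|$ is the operator norm. For $n=2$ and $p\geq n/2=1$, the Burkholder integrand is $$B_p(A)=\Big(\Big|1-\frac 2p\Big|\,|A|^2+\det A\Big)|A|^{p-2},\qquad B_p(0)=0,$$ and $B_p^+=\max\{0,B_p\}$. For $A\in\mathbb{R}^{2\times 2}$, $M(A)=(A,\det A)\in\mathbb{R}^{5}$ denotes the vector of all minors of $A$. A function $F\colon\mathbb{R}^{2\times2}\to\mathbb{R}$ is polyconvex at $A$ if there is a convex function $G\colon\mathbb{R}^{5}\to\mathbb{R}$ such that $F(A)=G(M(A))$ and $F\geq G\circ M$ on $\mathbb{R}^{2\times 2}$; $F$ is polyconvex if it is polyconvex at every $A\in\mathbb{R}^{2\times 2}$. *)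

theory Defs
  imports "HOL-Analysis.Analysis"
begin

definition op_norm :: "real^2^2 \<Rightarrow> real"
  where "op_norm A = onorm (\<lambda>x. A *v x)"

definition burkholder :: "real \<Rightarrow> real^2^2 \<Rightarrow> real"
  where "burkholder p A =
    (if A = 0 then 0
     else (\<bar>1 - 2 / p\<bar> * (op_norm A)\<^sup>2 + det A) * op_norm A powr (p - 2))"

definition burkholder_pos :: "real \<Rightarrow> real^2^2 \<Rightarrow> real"
  where "burkholder_pos p A = max 0 (burkholder p A)"

lemma burkholder_pos_nonneg: "0 \<le> burkholder_pos p A"
  by (simp add: burkholder_pos_def)

(* The pair type (real^2^2) * real is the five-dimensional real vector space of minors. *)
definition minors :: "real^2^2 \<Rightarrow> (real^2^2) \<times> real"
  where "minors A = (A, det A)"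

definition polyconvex_at :: "(real^2^2 \<Rightarrow> real) \<Rightarrow> real^2^2 \<Rightarrow> bool"
  where "polyconvex_at F A \<longleftrightarrow>
    (\<exists>G. convex_on UNIV G \<and> F A = G (minors A) \<and> (\<forall>X. F X \<ge> G (minors X)))"

definition polyconvex :: "(real^2^2 \<Rightarrow> real) \<Rightarrow> bool"
  where "polyconvex F \<longleftrightarrow> (\<forall>A. polyconvex_at F A)"

(* onorm is a supremum of quotients; it equals the supremum over the unit circle. *)
lemma op_norm_eq_Sup_sphere: "op_norm A = (SUP x\<in>sphere 0 1. norm (A *v x))"
proof -
  have bl: "bounded_linear (\<lambda>x. A *v x)"
    by (rule matrix_vector_mul_bounded_linear)
  have le1: "norm (A *v x) \<le> onorm (\<lambda>x. A *v x)" if "x \<in> sphere 0 1" for x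
    using onorm[OF bl, of x] that by simp
  have bdd: "bdd_above ((\<lambda>x. norm (A *v x)) ` sphere 0 1)"
    using le1 by (rule bdd_aboveI2)
  have ne: "sphere (0::real^2) 1 \<noteq> {}" by simp
  have upper: "norm (A *v x) \<le> (SUP x\<in>sphere 0 1. norm (A *v x)) * norm x" for x :: "real^2"
  proof (cases "x = 0")
    case False
    have "norm (A *v (x /\<^sub>R norm x)) \<le> (SUP x\<in>sphere 0 1. norm (A *v x))"
      by (rule cSUP_upper[OF _ bdd]) (simp add: False)
    moreover have "norm (A *v (x /\<^sub>R norm x)) = norm (A *v x) / norm x"
      by (simp add: matrix_vector_mult_scaleR divide_inverse mult.commute)
    ultimately have "norm (A *v x) / norm x \<le> (SUP x\<in>sphere 0 1. norm (A *v x))"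
      by simp
    then show ?thesis using False by (simp add: pos_divide_le_eq)
  qed simp
  show ?thesis unfolding op_norm_def
  proof (rule antisym)
    show "onorm (\<lambda>x. A *v x) \<le> (SUP x\<in>sphere 0 1. norm (A *v x))"
      by (rule onorm_le) (rule upper)
    show "(SUP x\<in>sphere 0 1. norm (A *v x)) \<le> onorm (\<lambda>x. A *v x)"
      by (rule cSUP_least[OF ne le1])
  qed
qed

end

theory Submission
  imports Defs
begin

text \<open>
  Identify a matrix with the map \<open>z \<mapsto> a z + b cnj z\<close> and put \<open>x = |a|\<close>, \<open>y = |b|\<close>. Then
  \<open>|A| = x + y\<close> and \<open>det A = x\<^sup>2 - y\<^sup>2\<close>, so with \<open>s = x + y\<close>, \<open>d = x - y\<close> and \<open>c = 1 - 2/p\<close> the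
  integrand is \<open>(c s + d) s powr (p - 1)\<close>. Since \<open>y\<close> is a seminorm, for every \<open>t > 0\<close> the function
  \<open>- (p - 1) c t powr p + 2 (p - 2) t powr (p - 1) y + (p - 1) t powr (p - 2) det\<close>
  is a convex function of the minors. It coincides with the integrand on \<open>s = t\<close>, whatever
  \<open>d\<close> is, and the coefficients are forced by also asking for first-order contact with zero
  where \<open>s = t\<close> meets \<open>c s + d = 0\<close>. For fixed \<open>s\<close> both sides are piecewise
  affine in \<open>d\<close>, which reduces the global comparison with the positive part to the endpoints
  \<open>d = - s\<close> and \<open>d = - c s\<close> and to Bernoulli's inequality between the slopes.
\<close>

section \<open>Moduli of the two coefficients of \<open>a z + b cnj z\<close>, determinant and
  operator norm\<close>

definition conformal_norm :: "real^2^2 \<Rightarrow> real"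
  where "conformal_norm A = cmod (Complex (A$1$1 + A$2$2) (A$2$1 - A$1$2)) / 2"

definition anticonformal_norm :: "real^2^2 \<Rightarrow> real"
  where "anticonformal_norm A = cmod (Complex (A$1$1 - A$2$2) (A$2$1 + A$1$2)) / 2"

lemma conformal_norm_nonneg: "0 \<le> conformal_norm A"
  and anticonformal_norm_nonneg: "0 \<le> anticonformal_norm A"
  by (simp_all add: conformal_norm_def anticonformal_norm_def)

lemma conformal_norm_power2:
  "(conformal_norm A)\<^sup>2 = ((A$1$1 + A$2$2)\<^sup>2 + (A$2$1 - A$1$2)\<^sup>2) / 4"
  by (simp add: conformal_norm_def power_divide cmod_power2)

lemma anticonformal_norm_power2:
  "(anticonformal_norm A)\<^sup>2 = ((A$1$1 - A$2$2)\<^sup>2 + (A$2$1 + A$1$2)\<^sup>2) / 4"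
  by (simp add: anticonformal_norm_def power_divide cmod_power2)

lemma det_eq_conformal_norms: "det A = (conformal_norm A)\<^sup>2 - (anticonformal_norm A)\<^sup>2"
  unfolding conformal_norm_power2 anticonformal_norm_power2
  by (simp add: det_2 power2_eq_square field_simps)

lemma anticonformal_norm_add: "anticonformal_norm (A + B) \<le> anticonformal_norm A + anticonformal_norm B"
  using norm_triangle_ineq[of "Complex (A$1$1 - A$2$2) (A$2$1 + A$1$2)"
      "Complex (B$1$1 - B$2$2) (B$2$1 + B$1$2)"]
  by (simp add: anticonformal_norm_def complex_add algebra_simps)

lemma anticonformal_norm_scaleR: "anticonformal_norm (r *\<^sub>R A) = \<bar>r\<bar> * anticonformal_norm A"
proof -
  have "Complex (r * A$1$1 - r * A$2$2) (r * A$2$1 + r * A$1$2)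
      = r *\<^sub>R Complex (A$1$1 - A$2$2) (A$2$1 + A$1$2)"
    by (simp add: complex_eq_iff algebra_simps)
  then show ?thesis
    by (simp add: anticonformal_norm_def)
qed

text \<open>In complex notation \<open>|A v|^2\<close> is \<open>(x^2 + y^2) |v|^2\<close> plus the
  inner product of \<open>P + i Q\<close> with the complex square of \<open>v\<close>. As
  \<open>|P + i Q| = 2 x y\<close>, Cauchy-Schwarz bounds this by \<open>(x + y)^2 |v|^2\<close>,
  with equality in a suitable direction.\<close>

lemma op_norm_eq_conformal_norms: "op_norm A = conformal_norm A + anticonformal_norm A"
proof -
  let ?x = "conformal_norm A" and ?y = "anticonformal_norm A"
  \<comment> \<open>\<open>P\<close> and \<open>Q\<close> are the entries of the trace-free part of
    the symmetric matrix \<open>transpose A ** A\<close>.\<close>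
  define P where "P = ((A$1$1)\<^sup>2 + (A$2$1)\<^sup>2 - (A$1$2)\<^sup>2 - (A$2$2)\<^sup>2) / 2"
  define Q where "Q = A$1$1 * A$1$2 + A$2$1 * A$2$2"
  have "(cmod (Complex P Q))\<^sup>2 = (2 * ?x * ?y)\<^sup>2"
    unfolding power_mult_distrib conformal_norm_power2 anticonformal_norm_power2 cmod_power2
    by (simp add: P_def Q_def power2_eq_square field_simps)
  then have R: "cmod (Complex P Q) = 2 * ?x * ?y"
    by (simp add: conformal_norm_nonneg anticonformal_norm_nonneg)
  have sq: "(norm (A *v v))\<^sup>2 = (?x\<^sup>2 + ?y\<^sup>2) * ((v$1)\<^sup>2 + (v$2)\<^sup>2)
      + (P * ((v$1)\<^sup>2 - (v$2)\<^sup>2) + Q * (2 * v$1 * v$2))" for v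
    unfolding conformal_norm_power2 anticonformal_norm_power2 power2_norm_eq_inner
    by (simp add: inner_vec_def matrix_vector_mult_def sum_2
        P_def Q_def power2_eq_square field_simps)
  show ?thesis unfolding op_norm_def
  proof (rule antisym)
    show "onorm ((*v) A) \<le> ?x + ?y"
    proof (rule onorm_le)
      fix v :: "real^2"
      have n: "(norm v)\<^sup>2 = (v$1)\<^sup>2 + (v$2)\<^sup>2"
        unfolding power2_norm_eq_inner by (simp add: inner_vec_def sum_2 power2_eq_square)
      have "(cmod (Complex ((v$1)\<^sup>2 - (v$2)\<^sup>2) (2 * v$1 * v$2)))\<^sup>2 = ((norm v)\<^sup>2)\<^sup>2"
        unfolding cmod_power2 n by (simp add: power2_eq_square algebra_simps)
      then have "cmod (Complex ((v$1)\<^sup>2 - (v$2)\<^sup>2) (2 * v$1 * v$2)) = (norm v)\<^sup>2"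
        by (rule power2_eq_imp_eq) simp_all
      then have "P * ((v$1)\<^sup>2 - (v$2)\<^sup>2) + Q * (2 * v$1 * v$2) \<le> 2 * ?x * ?y * (norm v)\<^sup>2"
        using norm_cauchy_schwarz[of "Complex P Q" "Complex ((v$1)\<^sup>2 - (v$2)\<^sup>2) (2 * v$1 * v$2)"] R
        by (simp add: inner_complex_def)
      then have "(norm (A *v v))\<^sup>2 \<le> ((?x + ?y) * norm v)\<^sup>2"
        unfolding sq n[symmetric] by (simp add: power2_eq_square algebra_simps)
      then show "norm (A *v v) \<le> (?x + ?y) * norm v"
        by (rule power2_le_imp_le)
          (simp add: conformal_norm_nonneg anticonformal_norm_nonneg)
    qed
    \<comment> \<open>Half the argument, so that the complex square of the unit vector
      \<open>v\<close> points along \<open>P + i Q\<close>.\<close>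
    define \<theta> where "\<theta> = Arg (Complex P Q) / 2"
    define v :: "real^2" where "v = vector [cos \<theta>, sin \<theta>]"
    have [simp]: "v$1 = cos \<theta>" "v$2 = sin \<theta>"
      by (simp_all add: v_def)
    have nv: "norm v = 1"
      by (simp add: norm_eq_1 inner_vec_def sum_2 flip: power2_eq_square)
    have "Complex P Q = rcis (2 * ?x * ?y) (2 * \<theta>)"
      using rcis_cmod_Arg[of "Complex P Q"] by (simp add: R \<theta>_def)
    then have "P = 2 * ?x * ?y * cos (2 * \<theta>)" "Q = 2 * ?x * ?y * sin (2 * \<theta>)"
      by (simp_all add: complex_eq_iff)
    then have "P * cos (2 * \<theta>) + Q * sin (2 * \<theta>)
        = 2 * ?x * ?y * ((cos (2 * \<theta>))\<^sup>2 + (sin (2 * \<theta>))\<^sup>2)"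
      by (simp only: power2_eq_square ring_distribs ac_simps)
    then have "P * cos (2 * \<theta>) + Q * sin (2 * \<theta>) = 2 * ?x * ?y"
      by simp
    then have "P * ((cos \<theta>)\<^sup>2 - (sin \<theta>)\<^sup>2) + Q * (2 * cos \<theta> * sin \<theta>) = 2 * ?x * ?y"
      unfolding cos_double sin_double by (simp only: ac_simps)
    then have "(norm (A *v v))\<^sup>2 = (?x + ?y)\<^sup>2"
      unfolding sq by (simp add: power2_sum)
    then have "norm (A *v v) = ?x + ?y"
      by (simp add: conformal_norm_nonneg anticonformal_norm_nonneg)
    then show "?x + ?y \<le> onorm ((*v) A)"
      using onorm[OF matrix_vector_mul_bounded_linear, of A v] nv by simp
  qed
qed

lemma op_norm_eq_0_iff: "op_norm A = 0 \<longleftrightarrow> A = 0"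
  unfolding op_norm_def
  by (subst onorm_eq_0[OF matrix_vector_mul_bounded_linear]) (metis matrix_eq matrix_vector_mult_0)

text \<open>The factorization \<open>det A = s * d\<close> releases one more power of
  \<open>s\<close>. At \<open>A = 0\<close> both sides vanish, as
  \<open>0 powr (p - 1) = 0\<close>.\<close>

lemma burkholder_eq:
  fixes A :: "real^2^2"
  assumes "p \<ge> 2"
  defines "s \<equiv> op_norm A" and "d \<equiv> conformal_norm A - anticonformal_norm A"
  shows "burkholder p A = ((1 - 2 / p) * s + d) * s powr (p - 1)"
proof (cases "A = 0")
  case True
  then show ?thesis
    by (simp add: burkholder_def s_def op_norm_eq_0_iff)
next
  case False
  then have "s > 0"
    using conformal_norm_nonneg[of A] anticonformal_norm_nonneg[of A] op_norm_eq_0_iff[of A]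
    by (simp add: s_def op_norm_eq_conformal_norms)
  then have "s powr (p - 1) = s * s powr (p - 2)"
    using powr_add[of s 1 "p - 2"] by simp
  moreover have "det A = s * d"
    by (simp add: s_def d_def op_norm_eq_conformal_norms det_eq_conformal_norms
        power2_eq_square algebra_simps)
  moreover have "\<bar>1 - 2 / p\<bar> = 1 - 2 / p"
    using assms(1) by simp
  ultimately show ?thesis
    using False by (simp add: burkholder_def s_def power2_eq_square algebra_simps)
qed

section \<open>Bernoulli's inequality and the comparison in two real variables\<close>

lemma powr_ge_tangent:
  fixes r q :: real
  assumes "0 \<le> r" "1 \<le> q"
  shows "1 + q * (r - 1) \<le> r powr q"
\<comment> \<open>The tangent at 1 is used on the open half-line; at \<open>r = 0\<close> the claim
  reads \<open>1 - q \<le> 0\<close>.\<close>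
proof (cases "r = 0")
  case False
  then have "r > 0" using assms by simp
  have "((\<lambda>x. x powr q) has_real_derivative q) (at 1 within {0<..})"
    by (auto intro!: derivative_eq_intros)
  then show ?thesis
    using convex_on_imp_above_tangent[OF powr_convex[OF assms(2)], of 1 r q] \<open>r > 0\<close>
    by (simp add: interior_open algebra_simps)
qed (use assms in simp)

text \<open>The comparison at \<open>t = 1\<close>, with \<open>r\<close> and \<open>e\<close>
  standing for \<open>s / t\<close> and \<open>d / t\<close>. The left side is affine in
  \<open>e\<close> with slope \<open>(p - 1) * r - (p - 2)\<close>; the right side is 0 up to
  \<open>e = - c * r\<close> and has slope \<open>r powr (p - 1)\<close> from there on.\<close>

lemma normalized_support:
  fixes p r e :: real
  assumes p: "p \<ge> 2" and e: "- r \<le> e" "e \<le> r"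
  defines "c \<equiv> 1 - 2 / p"
  shows "- (p - 1) * c + (p - 2) * (r - e) + (p - 1) * (r * e)
      \<le> max 0 ((c * r + e) * r powr (p - 1))"
proof -
  define l where "l e = - (p - 1) * c + (p - 2) * (r - e) + (p - 1) * (r * e)" for e
  have pc: "p - 2 = p * c" and c: "0 \<le> c" and r: "0 \<le> r"
    using assms by (auto simp: c_def field_simps)
  \<comment> \<open>The double zero at \<open>r = 1\<close> is the first-order contact with zero
    that fixes the coefficients.\<close>
  have kink: "l (- c * r) = - (p - 1) * c * (r - 1)\<^sup>2"
  proof -
    have "l (- c * r) = - (p - 1) * c + p * c * r + (p - 2) * c * r - (p - 1) * c * r\<^sup>2"
      using arg_cong[OF pc, of "\<lambda>u. u * r"] by (simp add: l_def power2_eq_square algebra_simps)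
    then show ?thesis by (simp add: power2_eq_square algebra_simps)
  qed
  then have l_kink: "l (- c * r) \<le> 0"
    using p c by (simp add: mult_nonpos_nonneg)
  have l_left: "l (- r) \<le> 0"
  proof -
    \<comment> \<open>Completing the square in \<open>r\<close>; the remainder is exactly
      \<open>- c\<close> because \<open>p * (p - 2) = (p - 1)\<^sup>2 - 1\<close>.\<close>
    have "(p - 1) * l (- r) = - ((p - 1) * r - (p - 2))\<^sup>2 - c"
      using p by (simp add: l_def c_def power2_eq_square field_simps)
    then have "(p - 1) * l (- r) \<le> 0"
      using c zero_le_power2[of "(p - 1) * r - (p - 2)"] by linarith
    then show ?thesis using p by (simp add: mult_le_0_iff)
  qed
  have affine: "l e = l e' + ((p - 1) * r - (p - 2)) * (e - e')" for e e'
    by (simp add: l_def algebra_simps)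
  show ?thesis
  proof (cases "- c * r \<le> e")
    case True
    \<comment> \<open>Bernoulli with exponent \<open>p - 1\<close> orders the two slopes, so the
      inequality at the kink persists to its right.\<close>
    have "(p - 1) * r - (p - 2) \<le> r powr (p - 1)"
      using powr_ge_tangent[of r "p - 1"] p r by (simp add: algebra_simps)
    then have "((p - 1) * r - (p - 2)) * (e - - c * r) \<le> r powr (p - 1) * (e - - c * r)"
      using True by (intro mult_right_mono) auto
    then have "l e \<le> r powr (p - 1) * (c * r + e)"
      using affine[of e "- c * r"] l_kink by (simp add: algebra_simps)
    then show ?thesis by (simp add: l_def mult.commute le_max_iff_disj)
  next
    case False
    \<comment> \<open>Left of the kink, the sign of the slope decides which endpoint,
      \<open>- c * r\<close> or \<open>- r\<close>, bounds \<open>l e\<close> from above.\<close>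
    have "l e \<le> 0"
    proof (cases "0 \<le> (p - 1) * r - (p - 2)")
      case True
      then have "((p - 1) * r - (p - 2)) * (e - - c * r) \<le> 0"
        using False by (intro mult_nonneg_nonpos) auto
      then show ?thesis
        using affine[of e "- c * r"] l_kink by linarith
    next
      case neg: False
      then have "((p - 1) * r - (p - 2)) * (e - - r) \<le> 0"
        using e by (intro mult_nonpos_nonneg) auto
      then show ?thesis
        using affine[of e "- r"] l_left by linarith
    qed
    then show ?thesis by (simp add: l_def le_max_iff_disj)
  qed
qed

section \<open>Convex supporting functions on the space of minors\<close>

definition burkholder_support :: "real \<Rightarrow> real \<Rightarrow> (real^2^2) \<times> real \<Rightarrow> real"
  where "burkholder_support p t z =
    - (p - 1) * (1 - 2 / p) * t powr p
    + 2 * (p - 2) * t powr (p - 1) * anticonformal_norm (fst z)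
    + (p - 1) * t powr (p - 2) * snd z"

text \<open>The seminorm has a nonnegative coefficient since \<open>p \<ge> 2\<close>, and the
  determinant slot enters affinely.\<close>

lemma convex_on_burkholder_support:
  assumes "p \<ge> 2"
  shows "convex_on UNIV (burkholder_support p t)"
proof -
  have "convex_on UNIV anticonformal_norm"
  proof (rule convex_onI)
    fix u :: real and A B :: "real^2^2" assume "0 < u" "u < 1"
    then show "anticonformal_norm ((1 - u) *\<^sub>R A + u *\<^sub>R B)
        \<le> (1 - u) * anticonformal_norm A + u * anticonformal_norm B"
      using anticonformal_norm_add[of "(1 - u) *\<^sub>R A" "u *\<^sub>R B"]
      by (simp add: anticonformal_norm_scaleR)
  qed simp
  then have "convex_on UNIV (\<lambda>z::(real^2^2) \<times> real. anticonformal_norm (fst z))"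
    by (simp add: convex_on_def)
  then have 1: "convex_on UNIV (\<lambda>z::(real^2^2) \<times> real.
      2 * (p - 2) * t powr (p - 1) * anticonformal_norm (fst z))"
    using assms by (intro convex_on_cmul) auto
  have 2: "convex_on UNIV (\<lambda>z::(real^2^2) \<times> real. a + b * snd z)" for a b
    by (rule convex_onI) (simp_all add: algebra_simps)
  have "burkholder_support p t = (\<lambda>z. 2 * (p - 2) * t powr (p - 1) * anticonformal_norm (fst z)
      + (- (p - 1) * (1 - 2 / p) * t powr p + (p - 1) * t powr (p - 2) * snd z))"
    by (simp add: burkholder_support_def fun_eq_iff)
  then show ?thesis
    by (simp only: convex_on_add[OF 1 2])
qed

text \<open>Homogeneity of degree \<open>p\<close> in \<open>t\<close> and \<open>X\<close> jointly
  reduces the comparison to \<open>t = 1\<close>; here \<open>r - e\<close> is twice the scaled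
  anticonformal modulus and \<open>r * e\<close> the scaled determinant.\<close>

lemma burkholder_support_scaled:
  fixes X :: "real^2^2"
  assumes "p \<ge> 2" "t > 0"
  defines "r \<equiv> op_norm X / t" and "e \<equiv> (conformal_norm X - anticonformal_norm X) / t"
  shows "burkholder_support p t (minors X) = t powr p *
      (- (p - 1) * (1 - 2 / p) + (p - 2) * (r - e) + (p - 1) * (r * e))"
proof -
  have 1: "t powr p = t\<^sup>2 * t powr (p - 2)" "t powr (p - 1) = t * t powr (p - 2)"
    using powr_add[of t 2 "p - 2"] powr_add[of t 1 "p - 2"] assms(2) by simp_all
  have 2: "t * (r - e) = 2 * anticonformal_norm X" "t\<^sup>2 * (r * e) = det X"
    using assms(2)
    by (simp_all add: r_def e_def op_norm_eq_conformal_norms det_eq_conformal_norms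
        power2_eq_square field_simps)
  have "t powr p * (- (p - 1) * (1 - 2 / p) + (p - 2) * (r - e) + (p - 1) * (r * e))
      = - (p - 1) * (1 - 2 / p) * t powr p
        + (p - 2) * t powr (p - 1) * (t * (r - e)) + (p - 1) * t powr (p - 2) * (t\<^sup>2 * (r * e))"
    unfolding 1 by (simp only: power2_eq_square ring_distribs ac_simps)
  also have "\<dots> = burkholder_support p t (minors X)"
    unfolding 2 by (simp add: burkholder_support_def minors_def)
  finally show ?thesis ..
qed

lemma burkholder_scaled:
  fixes X :: "real^2^2"
  assumes "p \<ge> 2" "t > 0"
  defines "r \<equiv> op_norm X / t" and "e \<equiv> (conformal_norm X - anticonformal_norm X) / t"
  shows "burkholder p X = t powr p * (((1 - 2 / p) * r + e) * r powr (p - 1))"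
proof -
  have "op_norm X = t * r" "conformal_norm X - anticonformal_norm X = t * e" "0 \<le> r"
    using assms(2) conformal_norm_nonneg[of X] anticonformal_norm_nonneg[of X]
    by (simp_all add: r_def e_def op_norm_eq_conformal_norms)
  moreover have "t powr p = t * t powr (p - 1)"
    using powr_add[of t 1 "p - 1"] assms(2) by simp
  ultimately show ?thesis
    using assms(1,2) by (simp add: burkholder_eq powr_mult algebra_simps)
qed

lemma burkholder_support_le:
  assumes "p \<ge> 2" "t > 0"
  shows "burkholder_support p t (minors X) \<le> burkholder_pos p X"
proof -
  have nn: "0 \<le> conformal_norm X" "0 \<le> anticonformal_norm X"
    by (rule conformal_norm_nonneg anticonformal_norm_nonneg)+
  let ?r = "op_norm X / t" and ?e = "(conformal_norm X - anticonformal_norm X) / t"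
  have "- ?r \<le> ?e" "?e \<le> ?r"
    using assms(2) nn by (simp_all add: op_norm_eq_conformal_norms field_simps)
  then have "t powr p * (- (p - 1) * (1 - 2 / p) + (p - 2) * (?r - ?e) + (p - 1) * (?r * ?e))
      \<le> t powr p * max 0 (((1 - 2 / p) * ?r + ?e) * ?r powr (p - 1))"
    using normalized_support[OF assms(1), of ?r ?e] by (intro mult_left_mono) auto
  then show ?thesis
    unfolding burkholder_support_scaled[OF assms] burkholder_pos_def burkholder_scaled[OF assms]
    by (simp add: max_mult_distrib_left)
qed

text \<open>With \<open>t = op_norm A\<close> one has \<open>r = 1\<close>, and both scaled
  expressions become \<open>1 - 2 / p + e\<close>.\<close>

lemma burkholder_support_eq:
  assumes "p \<ge> 2" "op_norm A > 0"
  shows "burkholder_support p (op_norm A) (minors A) = burkholder p A"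
  unfolding burkholder_support_scaled[OF assms] burkholder_scaled[OF assms]
  using assms by (simp add: field_simps)

theorem proposition1p6:
  fixes p :: real
  assumes "p \<ge> 2"
  shows "polyconvex (burkholder_pos p)"
  unfolding polyconvex_def
proof
  fix A
  show "polyconvex_at (burkholder_pos p) A"
  proof (cases "burkholder p A \<le> 0")
    case True
    then show ?thesis
      unfolding polyconvex_at_def
      \<comment> \<open>Where the positive part vanishes, the zero function already touches it from
        below.\<close>
      by (intro exI[of _ "\<lambda>_. 0"]) (simp add: burkholder_pos_def convex_on_const)
  next
    case False
    then have "A \<noteq> 0"
      by (auto simp: burkholder_def)
    then have "op_norm A > 0"
      using op_norm_eq_0_iff[of A] conformal_norm_nonneg[of A] anticonformal_norm_nonneg[of A]
      by (simp add: op_norm_eq_conformal_norms)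
    then show ?thesis
      unfolding polyconvex_at_def
      using False convex_on_burkholder_support burkholder_support_le burkholder_support_eq assms
      by (intro exI[of _ "burkholder_support p (op_norm A)"]) (simp add: burkholder_pos_def)
  qed
qed

end
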